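(* Let $|\psi\rangle_{AB}$ (the donor) and $|\phi\rangle_{ab}$ (the acceptor) be pure two-qubit states, where $A,B,a,b$ are qubits, one party holds $A$ and $a$, and the other party holds $B$ and $b$. Let $\Delta E>0$ satisfy $\Delta E\le E(\psi)$ and $E(\phi)+\Delta E\le 1$, and let $|\psi'\rangle_{AB}$, $|\phi'\rangle_{ab}$ be pure two-qubit states with $E(\psi')=E(\psi)-\Delta E$ and $E(\phi')=E(\phi)+\Delta E$. Suppose that $|\psi\rangle_{AB}\otimes|\phi\rangle_{ab}$ can be transformed with certainty into $|\psi'\rangle_{AB}\otimes|\phi'\rangle_{ab}$ by LOCC in the presence of a catalytic state. Then $E(\phi)\le E(\psi)-\Delta E$.
   Context: For a bipartite pure state with Schmidt coefficients $\{\lambda_i\}$ (nonnegative numbers with sum $1$: the eigenvalues of the reduced density matrix), $E=-\sum_i\lambda_i\log_2\lambda_i$ denotes the entropy of entanglement. LOCC means local operations and classical communication. By Nielsen's majorization theorem (known), a bipartite pure state with decreasingly ordered Schmidt coefficients $\lambda_1\ge\dots\ge\lambda_d$ can be transformed with certainty by LOCC into one with decreasingly ordered Schmidt coefficients $\lambda_1'\ge\dots\ge\lambda_d'$ (padded by zeros to the same length) if and only if $\sum_{i\le k}\lambda_i'\ge\sum_{i\le k}\lambda_i$ for all $k=1,\dots,d$. This may be taken as the definition of LOCC-transformability of pure states. A bipartite pure state $|\Psi\rangle$ can be transformed into $|\Psi'\rangle$ by LOCC in the presence of a catalytic state if there is a finite-dimensional bipartite pure state $|\chi\rangle$, shared by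 the same two parties, such that $|\Psi\rangle\otimes|\chi\rangle$ can be transformed with certainty by LOCC into $|\Psi'\rangle\otimes|\chi\rangle$. Schmidt coefficients of tensor products of bipartite states shared by the same two parties are the products of the Schmidt coefficients of the factors; here the bipartition of $|\psi\rangle_{AB}\otimes|\phi\rangle_{ab}$ is $Aa:Bb$. *)

theory Defs
  imports
    "HOL-Library.More_List"
    "Jordan_Normal_Form.Char_Poly"
begin

text \<open>
  A vector of \<open>\<complex>\<^sup>m \<otimes> \<complex>\<^sup>n\<close>, where the first party holds the
  \<open>m\<close>-dimensional and the second party the \<open>n\<close>-dimensional factor, is given by
  its \<open>m \<times> n\<close> matrix of amplitudes \<open>c\<close> in the computational product basis: the
  vector is the sum over \<open>i < m\<close> and \<open>j < n\<close> of
  \<open>c $$ (i, j)\<close> times \<open>|i\<rangle> \<otimes> |j\<rangle>\<close>.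
\<close>

definition pure_state :: "nat \<Rightarrow> nat \<Rightarrow> complex mat \<Rightarrow> bool" where
  "pure_state m n \<psi> \<longleftrightarrow>
     \<psi> \<in> carrier_mat m n \<and> (\<Sum>i<m. \<Sum>j<n. (cmod (\<psi> $$ (i, j)))\<^sup>2) = 1"

text \<open>
  The partial trace of \<open>|\<psi>\<rangle>\<langle>\<psi>|\<close> over the second party.
\<close>

definition reduced_density :: "complex mat \<Rightarrow> complex mat" where
  "reduced_density \<psi> =
     mat (dim_row \<psi>) (dim_row \<psi>)
       (\<lambda>(i, i'). \<Sum>j<dim_col \<psi>. \<psi> $$ (i, j) * cnj (\<psi> $$ (i', j)))"

text \<open>
  The eigenvalues are counted with multiplicity and include zeros. They are real because the
  reduced density matrix is Hermitian, so \<open>Re\<close> only changes the type.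
\<close>

definition schmidt_coeffs :: "complex mat \<Rightarrow> real list" where
  "schmidt_coeffs \<psi> =
     rev (sorted_list_of_multiset (image_mset Re (proots (char_poly (reduced_density \<psi>)))))"

text \<open>
  Since \<open>log 2 0 = 0\<close>, vanishing Schmidt coefficients contribute \<open>0\<close>.
\<close>

definition entanglement_entropy :: "complex mat \<Rightarrow> real" where
  "entanglement_entropy \<psi> = - (\<Sum>x\<leftarrow>schmidt_coeffs \<psi>. x * log 2 x)"

text \<open>
  If \<open>\<psi>\<close> is shared as \<open>A : B\<close> and \<open>\<phi>\<close> as \<open>a : b\<close>, then the
  product has bipartition \<open>Aa : Bb\<close>. The basis vector \<open>|i\<rangle>|k\<rangle>\<close> of
  \<open>Aa\<close> has index \<open>i * dim a + k\<close>, and likewise for \<open>Bb\<close>, so that the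
  amplitude matrix is the Kronecker product of the two amplitude matrices.
\<close>

definition tensor_state :: "complex mat \<Rightarrow> complex mat \<Rightarrow> complex mat" where
  "tensor_state \<psi> \<phi> =
     mat (dim_row \<psi> * dim_row \<phi>) (dim_col \<psi> * dim_col \<phi>)
       (\<lambda>(i, j). \<psi> $$ (i div dim_row \<phi>, j div dim_col \<phi>)
              * \<phi> $$ (i mod dim_row \<phi>, j mod dim_col \<phi>))"

text \<open>
  Deterministic LOCC-transformability of bipartite pure states, via Nielsen's majorization
  theorem; \<open>nth_default 0\<close> pads the shorter list by zeros.
\<close>

definition locc_transformable :: "complex mat \<Rightarrow> complex mat \<Rightarrow> bool" where
  "locc_transformable \<Psi> \<Psi>' \<longleftrightarrow>
     (let xs = schmidt_coeffs \<Psi>; ys = schmidt_coeffs \<Psi>'; d = max (length xs) (length ys)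
      in \<forall>k\<in>{1..d}. (\<Sum>i<k. nth_default 0 ys i) \<ge> (\<Sum>i<k. nth_default 0 xs i))"

definition catalytic_locc_transformable :: "complex mat \<Rightarrow> complex mat \<Rightarrow> bool" where
  "catalytic_locc_transformable \<Psi> \<Psi>' \<longleftrightarrow>
     (\<exists>m n \<chi>. pure_state m n \<chi> \<and>
        locc_transformable (tensor_state \<Psi> \<chi>) (tensor_state \<Psi>' \<chi>))"

end

(*
  Majorization at k = 1 compares largest Schmidt coefficients. These are multiplicative under
  tensor products, so the catalyst cancels and p q <= p' q', where p, q, p', q' are the largest
  coefficients of psi, phi, psi', phi'. If E(phi) > E(psi'), then q < p' and q' < p, q. As a
  function of the logarithm of its largest coefficient, the entropy of a qubit pair is strictly
  concave and decreasing, whence h(p) + h(q) > h(q') + h(p q / q') >= h(q') + h(p'), against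
  E(psi) + E(phi) = E(psi') + E(phi').
*)
theory Submission
  imports
    Defs
    "Jordan_Normal_Form.Schur_Decomposition"
    "HOL-Real_Asymp.Real_Asymp"
begin

subsection \<open>Binary entropy\<close>

text \<open>Entropy in nats: natural logarithms keep the derivatives free of constants, and the
  factor \<open>ln 2\<close> enters only in the comparison with
  \<open>entanglement_entropy\<close>.\<close>

definition bin_entropy :: "real \<Rightarrow> real" where
  "bin_entropy x = - (x * ln x + (1 - x) * ln (1 - x))"

text \<open>Only the endpoint 0 needs an argument: the one-sided limit of x ln x there is 0, which
  is also the value. Continuity up to the boundary lets the later monotonicity arguments include the
  coefficient 1 of product states, where the entropy has infinite slope.\<close>

lemma continuous_on_mult_ln: "continuous_on {0..} (\<lambda>x::real. x * ln x)"
proof -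
  have "continuous (at x within {0..}) (\<lambda>x::real. x * ln x)" if "x \<ge> 0" for x
  proof (cases "x = 0")
    case True
    have "((\<lambda>x::real. x * ln x) \<longlongrightarrow> 0) (at_right 0)"
      by real_asymp
    moreover have "at (0::real) within {0..} = at_right 0"
      by (simp add: at_within_Ici_at_right)
    ultimately show ?thesis
      using True by (simp add: continuous_within)
  next
    case False
    then show ?thesis
      by (intro continuous_intros) auto
  qed
  then show ?thesis
    by (simp add: continuous_on_eq_continuous_within)
qed

lemma continuous_on_bin_entropy: "continuous_on {0..1} bin_entropy"
proof -
  have "continuous_on {0..1} (\<lambda>x::real. x * ln x)"
    by (rule continuous_on_subset[OF continuous_on_mult_ln]) auto
  moreover have "continuous_on {0..1} (\<lambda>x::real. (1 - x) * ln (1 - x))"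
    by (rule continuous_on_compose2[OF continuous_on_mult_ln, where f = "\<lambda>x. 1 - x"])
       (auto intro!: continuous_intros)
  ultimately show ?thesis
    unfolding bin_entropy_def[abs_def] by (intro continuous_on_minus continuous_on_add)
qed

lemma DERIV_bin_entropy:
  assumes "0 < x" "x < 1"
  shows "(bin_entropy has_real_derivative (ln (1 - x) - ln x)) (at x)"
  unfolding bin_entropy_def[abs_def]
  using assms by (auto intro!: derivative_eq_intros)

lemma bin_entropy_antimono:
  assumes "1/2 \<le> x" "x \<le> y" "y \<le> 1"
  shows "bin_entropy y \<le> bin_entropy x"
proof (cases "x = y")
  case False
  have "bin_entropy y < bin_entropy x"
  \<comment> \<open>The derivative is needed only strictly between x and y, so \<open>y = 1\<close>
    is covered. There z > 1/2, hence 1 - z < z and the slope is negative.\<close>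
  proof (rule DERIV_neg_imp_decreasing_open[where f = bin_entropy and a = x and b = y])
    show "x < y" using assms False by simp
    show "continuous_on {x..y} bin_entropy"
      using assms by (intro continuous_on_subset[OF continuous_on_bin_entropy]) auto
  next
    fix z assume "x < z" "z < y"
    then have "(bin_entropy has_real_derivative (ln (1 - z) - ln z)) (at z)"
      "ln (1 - z) - ln z < 0"
      using assms by (auto intro: DERIV_bin_entropy)
    then show "\<exists>d. DERIV bin_entropy z :> d \<and> d < 0" by blast
  qed
  then show ?thesis by simp
qed simp

text \<open>This weight is minus the derivative of \<open>bin_entropy\<close> with respect to ln x,
  so its growth is strict concavity in ln x. Both factors increase; from 1/2 on the log odds are
  nonnegative, so the product increases too.\<close>

lemma log_odds_weight_strict_mono:
  fixes x y :: real
  assumes "1/2 \<le> x" "x < y" "y < 1"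
  shows "x * (ln x - ln (1 - x)) < y * (ln y - ln (1 - y))"
proof (rule mult_strict_mono)
  show "ln x - ln (1 - x) < ln y - ln (1 - y)"
    using assms by (intro diff_strict_mono) auto
qed (use assms in auto)

text \<open>Strict concavity of \<open>bin_entropy\<close> as a function of \<open>ln x\<close> on \<open>[1/2, 1]\<close>.\<close>

lemma bin_entropy_exchange:
  assumes "1/2 \<le> x" "x < y" "1 < t" "y * t \<le> 1"
  shows "bin_entropy x + bin_entropy (y * t) < bin_entropy (x * t) + bin_entropy y"
proof -
  \<comment> \<open>Scaling both arguments by s shifts both logarithms by ln s. The claim,
    rearranged, says that this difference is larger at s = t than at s = 1.\<close>
  let ?F = "\<lambda>s. bin_entropy (x * s) - bin_entropy (y * s)"
  have bnd: "1/2 \<le> x * s" "x * s < y * s" "y * s \<le> y * t" if "1 \<le> s" "s \<le> t" for s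
  proof -
    show "1/2 \<le> x * s" using mult_mono[of "1/2" x 1 s] assms that by simp
    show "x * s < y * s" "y * s \<le> y * t" using assms that by auto
  qed
  have "?F 1 < ?F t"
  proof (rule DERIV_pos_imp_increasing_open[OF \<open>1 < t\<close>])
    have bnd': "x * s \<in> {0..1} \<and> y * s \<in> {0..1}" if "s \<in> {1..t}" for s
    proof -
      have "1/2 \<le> x * s" "x * s < y * s" "y * s \<le> 1"
        using bnd[of s] that order.trans[OF _ assms(4)] by (simp_all only: atLeastAtMost_iff)
      then show ?thesis unfolding atLeastAtMost_iff by linarith
    qed
    show "continuous_on {1..t} ?F"
      using bnd'
      by (intro continuous_on_diff continuous_on_compose2[OF continuous_on_bin_entropy])
         (auto intro!: continuous_intros)
  next
    \<comment> \<open>For s strictly below t the argument \<open>y * s\<close> stays below 1, even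
      when \<open>y * t = 1\<close>, so \<open>bin_entropy\<close> is differentiable there.\<close>
    fix s assume s: "1 < s" "s < t"
    then have "y * s < y * t" using assms by simp
    then have ys: "1/2 \<le> x * s" "x * s < y * s" "y * s < 1"
      using bnd[of s] s less_le_trans[OF _ assms(4)] by (simp_all only: less_imp_le)
    let ?D = "(ln (1 - x * s) - ln (x * s)) * x - (ln (1 - y * s) - ln (y * s)) * y"
    have "DERIV ?F s :> ?D"
      using ys
      by (intro DERIV_diff DERIV_chain'[where g = bin_entropy] DERIV_bin_entropy)
         (auto intro!: derivative_eq_intros)
    \<comment> \<open>The factor s completes the chain-rule factors x and y to the arguments
      \<open>x * s\<close> and \<open>y * s\<close>, giving a difference of two log-odds
      weights.\<close>
    moreover have "0 < s * ?D"
      using log_odds_weight_strict_mono[OF ys] by (simp add: algebra_simps)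
    then have "0 < ?D" using s by (simp add: zero_less_mult_iff)
    ultimately show "\<exists>d. DERIV ?F s :> d \<and> d > 0" by blast
  qed
  then show ?thesis by simp
qed

text \<open>The numerical core of the theorem: the four variables stand for largest Schmidt
  coefficients, and \<open>prod\<close> is all that remains of the LOCC condition.\<close>

lemma entropy_balance_le:
  assumes p: "1/2 \<le> p" "p \<le> 1" and q: "1/2 \<le> q" "q \<le> 1"
    and p': "1/2 \<le> p'" "p' \<le> 1" and q': "1/2 \<le> q'" "q' \<le> 1"
    and prod: "p * q \<le> p' * q'"
    and bal: "bin_entropy p + bin_entropy q = bin_entropy p' + bin_entropy q'"
    and gain: "bin_entropy q < bin_entropy q'"
  shows "bin_entropy q \<le> bin_entropy p'"
proof (rule ccontr)
  assume "\<not> bin_entropy q \<le> bin_entropy p'"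
  \<comment> \<open>By \<open>bal\<close>, the second inequality is equivalent to the first.\<close>
  then have "bin_entropy p' < bin_entropy q" "bin_entropy p < bin_entropy q'"
    using bal gain by auto
  then have "q < p'" "q' < p"
    using bin_entropy_antimono p q p' q' by (meson not_le)+
  moreover have "q' < q"
    using bin_entropy_antimono gain q q' by (meson not_le)
  \<comment> \<open>The pair \<open>q'\<close>, \<open>p * t\<close> has the same product as
    \<open>q\<close>, \<open>p\<close> but is spread further apart, and \<open>prod\<close> bounds
    its second entry by \<open>p'\<close>.\<close>
  moreover define t where "t = q / q'"
  have t: "q' * t = q" "p * t \<le> p'"
    using q' prod by (auto simp: t_def field_simps)
  ultimately have "1 < t" "q' < p" using q' by (simp_all add: t_def)
  have "p * t \<le> 1" using t p' by linarith
  \<comment> \<open>Spreading a pair at fixed product strictly lowers the total entropy. Raising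
    \<open>p * t\<close> to \<open>p'\<close> then lowers it further, which contradicts
    \<open>bal\<close>.\<close>
  then have "bin_entropy q' + bin_entropy (p * t) < bin_entropy q + bin_entropy p"
    using bin_entropy_exchange[of q' p t] t q' \<open>q' < p\<close> \<open>1 < t\<close> by simp
  moreover have "1/2 \<le> p * t"
    using mult_mono[of "1/2" p 1 t] p \<open>1 < t\<close> by simp
  then have "bin_entropy p' \<le> bin_entropy (p * t)"
    using bin_entropy_antimono t p' by blast
  ultimately show False using bal by simp
qed

subsection \<open>Spectrum of a tensor product\<close>

text \<open>The index i * n + j is the basis numbering used by \<open>tensor_state\<close>; sums
  over a composite index thereby become double sums that factor.\<close>

lemma sum_div_mod:
  fixes f :: "nat \<Rightarrow> nat \<Rightarrow> 'a::comm_monoid_add"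
  shows "(\<Sum>i<m * n. f (i div n) (i mod n)) = (\<Sum>i<m. \<Sum>j<n. f i j)"
proof -
  have "(\<Sum>i<m * n. f (i div n) (i mod n)) = (\<Sum>i<m. \<Sum>k\<in>{i * n..<i * n + n}. f (k div n) (k mod n))"
    by (rule sum.nat_group[symmetric])
  also have "\<dots> = (\<Sum>i<m. \<Sum>j<n. f i j)"
  proof (rule sum.cong[OF refl])
    fix i
    have "k div n = i" "k mod n = k - i * n" if "i * n \<le> k" "k < i * n + n" for k
    proof -
      show "k div n = i" using that by (intro div_nat_eqI) (auto simp: algebra_simps)
      then show "k mod n = k - i * n" by (metis minus_div_mult_eq_mod)
    qed
    then show "(\<Sum>k\<in>{i * n..<i * n + n}. f (k div n) (k mod n)) = (\<Sum>j<n. f i j)"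
      by (intro sum.reindex_bij_witness[where i = "\<lambda>j. i * n + j" and j = "\<lambda>k. k - i * n"]) auto
  qed
  finally show ?thesis .
qed

section \<open>Algebra of the Kronecker product\<close>

lemma tensor_state_carrier:
  assumes "A \<in> carrier_mat m n" "B \<in> carrier_mat k l"
  shows "tensor_state A B \<in> carrier_mat (m * k) (n * l)"
  using assms by (auto simp: tensor_state_def)

lemma tensor_state_index:
  assumes "A \<in> carrier_mat m n" "B \<in> carrier_mat k l" "i < m * k" "j < n * l"
  shows "tensor_state A B $$ (i, j) = A $$ (i div k, j div l) * B $$ (i mod k, j mod l)"
  using assms by (auto simp: tensor_state_def)

lemma div_mod_less:
  fixes i :: nat
  assumes "i < m * k"
  shows "i div k < m" "i mod k < k"
proof -
  have "0 < k" using assms by (cases k) auto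
  then show "i div k < m" "i mod k < k"
    using assms by (auto simp: less_mult_imp_div_less)
qed

text \<open>The mixed-product rule: the inner sum over a composite index splits into one sum per
  factor. It carries inverses and conjugations over to tensor products.\<close>

lemma tensor_state_mult:
  assumes A: "A \<in> carrier_mat m n" and B: "B \<in> carrier_mat k l"
    and C: "C \<in> carrier_mat n r" and D: "D \<in> carrier_mat l s"
  shows "tensor_state A B * tensor_state C D = tensor_state (A * C) (B * D)"
proof (rule eq_matI)
  have AC: "A * C \<in> carrier_mat m r" and BD: "B * D \<in> carrier_mat k s"
    using assms by auto
  note dims = tensor_state_carrier[OF A B] tensor_state_carrier[OF C D] tensor_state_carrier[OF AC BD]
  show "dim_row (tensor_state A B * tensor_state C D) = dim_row (tensor_state (A * C) (B * D))"
    "dim_col (tensor_state A B * tensor_state C D) = dim_col (tensor_state (A * C) (B * D))"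
    using dims by auto
  fix i j
  assume "i < dim_row (tensor_state (A * C) (B * D))" "j < dim_col (tensor_state (A * C) (B * D))"
  then have i: "i < m * k" and j: "j < r * s" using dims by auto
  have "(tensor_state A B * tensor_state C D) $$ (i, j) =
      (\<Sum>x<n * l. tensor_state A B $$ (i, x) * tensor_state C D $$ (x, j))"
    using dims i j by (auto simp: scalar_prod_def lessThan_atLeast0)
  also have "\<dots> = (\<Sum>x<n * l. (\<lambda>u v. A $$ (i div k, u) * B $$ (i mod k, v) *
      (C $$ (u, j div s) * D $$ (v, j mod s))) (x div l) (x mod l))"
    by (rule sum.cong) (auto simp: tensor_state_index[OF A B] tensor_state_index[OF C D] i j)
  also have "\<dots> = (\<Sum>u<n. \<Sum>v<l. A $$ (i div k, u) * B $$ (i mod k, v) *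
      (C $$ (u, j div s) * D $$ (v, j mod s)))"
    by (rule sum_div_mod)
  also have "\<dots> = (\<Sum>u<n. A $$ (i div k, u) * C $$ (u, j div s)) *
      (\<Sum>v<l. B $$ (i mod k, v) * D $$ (v, j mod s))"
    by (simp add: sum_product mult_ac)
  also have "\<dots> = (A * C) $$ (i div k, j div s) * (B * D) $$ (i mod k, j mod s)"
    using A B C D div_mod_less[OF i] div_mod_less[OF j]
    by (auto simp: scalar_prod_def lessThan_atLeast0)
  also have "\<dots> = tensor_state (A * C) (B * D) $$ (i, j)"
    by (rule tensor_state_index[OF AC BD i j, symmetric])
  finally show "(tensor_state A B * tensor_state C D) $$ (i, j) = tensor_state (A * C) (B * D) $$ (i, j)" .
qed

lemma tensor_state_one: "tensor_state (1\<^sub>m m) (1\<^sub>m n) = 1\<^sub>m (m * n)"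
proof (rule eq_matI)
  fix i j
  assume "i < dim_row (1\<^sub>m (m * n) :: complex mat)" "j < dim_col (1\<^sub>m (m * n) :: complex mat)"
  then have ij: "i < m * n" "j < m * n" by auto
  have "i = j \<longleftrightarrow> i div n = j div n \<and> i mod n = j mod n"
    by (metis div_mult_mod_eq)
  then show "tensor_state (1\<^sub>m m) (1\<^sub>m n) $$ (i, j) = 1\<^sub>m (m * n) $$ (i, j)"
    using ij div_mod_less[OF ij(1)] div_mod_less[OF ij(2)]
    by (auto simp: tensor_state_index[OF one_carrier_mat one_carrier_mat])
qed (auto simp: tensor_state_def)

text \<open>Here \<open>tensor_state\<close> acts on operators. The tensor product of the two
  changes of basis conjugates one product into the other, by the mixed-product rule.\<close>

lemma similar_mat_tensor_state:
  assumes "similar_mat A A'" "similar_mat B B'"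
  shows "similar_mat (tensor_state A B) (tensor_state A' B')"
proof -
  obtain m P Q where A: "{A, A', P, Q} \<subseteq> carrier_mat m m" "P * Q = 1\<^sub>m m" "Q * P = 1\<^sub>m m" "A = P * A' * Q"
    using similar_matD[OF assms(1)] by blast
  obtain n R S where B: "{B, B', R, S} \<subseteq> carrier_mat n n" "R * S = 1\<^sub>m n" "S * R = 1\<^sub>m n" "B = R * B' * S"
    using similar_matD[OF assms(2)] by blast
  show ?thesis
  proof (rule similar_matI)
    show "{tensor_state A B, tensor_state A' B', tensor_state P R, tensor_state Q S}
        \<subseteq> carrier_mat (m * n) (m * n)"
      using A B by (auto intro!: tensor_state_carrier)
    show "tensor_state P R * tensor_state Q S = 1\<^sub>m (m * n)"
      "tensor_state Q S * tensor_state P R = 1\<^sub>m (m * n)"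
      using A B tensor_state_mult[of P m m R n n Q m S n] tensor_state_mult[of Q m m S n n P m R n]
      by (auto simp: tensor_state_one)
    have "tensor_state P R * tensor_state A' B' = tensor_state (P * A') (R * B')"
      using A B by (intro tensor_state_mult) auto
    moreover have "tensor_state (P * A') (R * B') * tensor_state Q S = tensor_state (P * A' * Q) (R * B' * S)"
      using A B by (intro tensor_state_mult) auto
    ultimately show "tensor_state A B = tensor_state P R * tensor_state A' B' * tensor_state Q S"
      using A B by simp
  qed
qed

lemma upper_triangular_tensor_state:
  assumes A: "A \<in> carrier_mat m m" "upper_triangular A"
    and B: "B \<in> carrier_mat n n" "upper_triangular B"
  shows "upper_triangular (tensor_state A B)"
proof (rule upper_triangularI)
  fix i j assume "j < i" "i < dim_row (tensor_state A B)"
  then have ij: "i < m * n" "j < m * n" "j < i"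
    using tensor_state_carrier[OF A(1) B(1)] by auto
  \<comment> \<open>If neither digit of j were smaller than that of i, then j could not be smaller
    than i. So one of the two factors is an entry below the diagonal.\<close>
  have "j div n < i div n \<or> j mod n < i mod n"
  proof (rule ccontr)
    assume "\<not> ?thesis"
    then have "i div n * n + i mod n \<le> j div n * n + j mod n"
      by (intro add_mono mult_right_mono) auto
    then show False using ij by simp
  qed
  then have "A $$ (i div n, j div n) = 0 \<or> B $$ (i mod n, j mod n) = 0"
    using upper_triangularD[OF A(2)] upper_triangularD[OF B(2)] A(1) B(1) div_mod_less[OF ij(1)]
    by blast
  then show "tensor_state A B $$ (i, j) = 0"
    by (auto simp: tensor_state_index[OF A(1) B(1) ij(1,2)])
qed

section \<open>Eigenvalues by triangularization\<close>

lemma complex_similar_upper_triangular: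
  fixes A :: "complex mat"
  assumes "A \<in> carrier_mat n n"
  obtains T where "T \<in> carrier_mat n n" "upper_triangular T" "similar_mat A T"
  using char_poly_factorized[OF assms] schur_decomposition_exists[OF assms] by blast

lemma eigenvalues_upper_triangular:
  fixes T :: "complex mat"
  assumes "T \<in> carrier_mat n n" "upper_triangular T"
  shows "proots (char_poly T) = mset (diag_mat T)"
proof -
  have "proots (\<Prod>a\<leftarrow>as. [:- a, 1:]) = mset as" for as :: "complex list"
  proof (induction as)
    case (Cons a as)
    have "(\<Prod>a\<leftarrow>as. [:- a, 1:]) \<noteq> 0" by (auto simp: prod_list_zero_iff)
    then show ?case using Cons by (simp add: proots_mult del: mult_pCons_left)
  qed simp
  then show ?thesis using char_poly_upper_triangular[OF assms] by simp
qed

text \<open>After triangularizing both factors, the product is triangular and its diagonal consists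
  of all products of diagonal entries. Sets suffice, since the spectrum of a product is used only
  through its maximum.\<close>

lemma set_proots_char_poly_tensor_state:
  assumes A: "A \<in> carrier_mat m m" and B: "B \<in> carrier_mat n n"
  shows "set_mset (proots (char_poly (tensor_state A B))) =
    {a * b | a b. a \<in># proots (char_poly A) \<and> b \<in># proots (char_poly B)}"
proof -
  obtain T where T: "T \<in> carrier_mat m m" "upper_triangular T" "similar_mat A T"
    using complex_similar_upper_triangular[OF A] .
  obtain S where S: "S \<in> carrier_mat n n" "upper_triangular S" "similar_mat B S"
    using complex_similar_upper_triangular[OF B] .
  have *: "set_mset (proots (char_poly C)) = (\<lambda>i. U $$ (i, i)) ` {..<k}"
    if "U \<in> carrier_mat k k" "upper_triangular U" "similar_mat C U" for C U :: "complex mat" and k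
    using that(1) unfolding char_poly_similar[OF that(3)] eigenvalues_upper_triangular[OF that(1,2)]
    by (auto simp: diag_mat_def)
  have "set_mset (proots (char_poly (tensor_state A B))) =
      (\<lambda>i. tensor_state T S $$ (i, i)) ` {..<m * n}"
    using T S by (intro * tensor_state_carrier upper_triangular_tensor_state similar_mat_tensor_state)
  also have "\<dots> = (\<lambda>i. T $$ (i div n, i div n) * S $$ (i mod n, i mod n)) ` {..<m * n}"
    by (rule image_cong) (auto simp: tensor_state_index[OF T(1) S(1)])
  also have "\<dots> = {T $$ (i, i) * S $$ (j, j) | i j. i < m \<and> j < n}"
  proof (intro equalityI subsetI)
    fix z assume "z \<in> (\<lambda>i. T $$ (i div n, i div n) * S $$ (i mod n, i mod n)) ` {..<m * n}"
    then show "z \<in> {T $$ (i, i) * S $$ (j, j) | i j. i < m \<and> j < n}"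
      using div_mod_less by blast
  next
    fix z assume "z \<in> {T $$ (i, i) * S $$ (j, j) | i j. i < m \<and> j < n}"
    then obtain i j where ij: "i < m" "j < n" "z = T $$ (i, i) * S $$ (j, j)" by blast
    \<comment> \<open>The index with digits i and j lies in block i, which ends at Suc i *
      n.\<close>
    have "i * n + j < Suc i * n" using ij by simp
    also have "\<dots> \<le> m * n" using ij by (intro mult_right_mono) auto
    finally have "i * n + j < m * n" .
    then show "z \<in> (\<lambda>i. T $$ (i div n, i div n) * S $$ (i mod n, i mod n)) ` {..<m * n}"
      using ij by (intro image_eqI[where x = "i * n + j"]) auto
  qed
  also have "\<dots> = {a * b | a b. a \<in># proots (char_poly A) \<and> b \<in># proots (char_poly B)}"
    unfolding *[OF T] *[OF S] by blast
  finally show ?thesis .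
qed

text \<open>Similar matrices have equal trace, and for a triangular matrix the diagonal lists the
  eigenvalues. This yields the normalization of Schmidt coefficients.\<close>

lemma sum_mset_proots_char_poly:
  assumes A: "A \<in> carrier_mat n n"
  shows "sum_mset (proots (char_poly A)) = (\<Sum>i<n. A $$ (i, i) :: complex)"
proof -
  obtain T where T: "T \<in> carrier_mat n n" "upper_triangular T" "similar_mat A T"
    using complex_similar_upper_triangular[OF A] .
  obtain P Q k where "{A, T, P, Q} \<subseteq> carrier_mat k k" "Q * P = 1\<^sub>m k" "A = P * T * Q"
    using similar_matD[OF T(3)] by blast
  moreover from this have "k = n" using A by auto
  ultimately have P: "P \<in> carrier_mat n n" and Q: "Q \<in> carrier_mat n n"
    and QP: "Q * P = 1\<^sub>m n" and eq: "A = P * T * Q" by auto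
  \<comment> \<open>Cyclicity of the trace, used to bring \<open>Q\<close> next to \<open>P\<close>
    so that they cancel.\<close>
  have comm: "(\<Sum>i<n. (X * Y) $$ (i, i)) = (\<Sum>i<n. (Y * X) $$ (i, i))"
    if "X \<in> carrier_mat n n" "Y \<in> carrier_mat n n" for X Y :: "complex mat"
  proof -
    have "(\<Sum>i<n. (X * Y) $$ (i, i)) = (\<Sum>i<n. \<Sum>j<n. X $$ (i, j) * Y $$ (j, i))"
      using that by (auto simp: scalar_prod_def lessThan_atLeast0)
    also have "\<dots> = (\<Sum>j<n. \<Sum>i<n. Y $$ (j, i) * X $$ (i, j))"
      by (subst sum.swap) (simp add: mult.commute)
    also have "\<dots> = (\<Sum>i<n. (Y * X) $$ (i, i))"
      using that by (auto simp: scalar_prod_def lessThan_atLeast0)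
    finally show ?thesis .
  qed
  have "(\<Sum>i<n. A $$ (i, i)) = (\<Sum>i<n. (Q * (P * T)) $$ (i, i))"
    using comm[of "P * T" Q] P Q T by (simp add: eq)
  also have "Q * (P * T) = Q * P * T"
    using P Q T by (intro assoc_mult_mat[symmetric]) auto
  also have "\<dots> = T" using T QP by simp
  finally have "(\<Sum>i<n. A $$ (i, i)) = (\<Sum>i<n. T $$ (i, i))" .
  moreover have "sum_list (diag_mat T) = (\<Sum>i<n. T $$ (i, i))"
    using T by (simp add: diag_mat_def interv_sum_list_conv_sum_set_nat lessThan_atLeast0)
  ultimately show ?thesis
    using T by (simp add: char_poly_similar[OF T(3)] eigenvalues_upper_triangular[OF T(1,2)] sum_mset_sum_list)
qed

section \<open>Reduced density matrices and Schmidt coefficients\<close>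

lemma reduced_density_carrier:
  "M \<in> carrier_mat m n \<Longrightarrow> reduced_density M \<in> carrier_mat m m"
  by (auto simp: reduced_density_def)

text \<open>Tracing out the second party is a sum over a composite column index, which factors into
  the two separate partial traces.\<close>

lemma reduced_density_tensor_state:
  assumes M: "M \<in> carrier_mat m n" and N: "N \<in> carrier_mat k l"
  shows "reduced_density (tensor_state M N) = tensor_state (reduced_density M) (reduced_density N)"
proof (rule eq_matI)
  note MN = tensor_state_carrier[OF M N]
  note RMN = tensor_state_carrier[OF reduced_density_carrier[OF M] reduced_density_carrier[OF N]]
  show "dim_row (reduced_density (tensor_state M N)) = dim_row (tensor_state (reduced_density M) (reduced_density N))"
    "dim_col (reduced_density (tensor_state M N)) = dim_col (tensor_state (reduced_density M) (reduced_density N))"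
    using reduced_density_carrier[OF MN] RMN by auto
  fix i i'
  assume "i < dim_row (tensor_state (reduced_density M) (reduced_density N))"
    "i' < dim_col (tensor_state (reduced_density M) (reduced_density N))"
  then have i: "i < m * k" "i' < m * k" using RMN by auto
  have "reduced_density (tensor_state M N) $$ (i, i') =
      (\<Sum>j<n * l. tensor_state M N $$ (i, j) * cnj (tensor_state M N $$ (i', j)))"
    using MN i by (simp add: reduced_density_def)
  also have "\<dots> = (\<Sum>j<n * l. (\<lambda>u v. M $$ (i div k, u) * N $$ (i mod k, v) *
      cnj (M $$ (i' div k, u) * N $$ (i' mod k, v))) (j div l) (j mod l))"
    by (rule sum.cong) (auto simp: tensor_state_index[OF M N] i)
  also have "\<dots> = (\<Sum>u<n. \<Sum>v<l. M $$ (i div k, u) * N $$ (i mod k, v) *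
      cnj (M $$ (i' div k, u) * N $$ (i' mod k, v)))"
    by (rule sum_div_mod)
  also have "\<dots> = (\<Sum>u<n. M $$ (i div k, u) * cnj (M $$ (i' div k, u))) *
      (\<Sum>v<l. N $$ (i mod k, v) * cnj (N $$ (i' mod k, v)))"
    by (simp add: sum_product mult_ac)
  also have "\<dots> = reduced_density M $$ (i div k, i' div k) * reduced_density N $$ (i mod k, i' mod k)"
    using M N div_mod_less[OF i(1)] div_mod_less[OF i(2)] by (simp add: reduced_density_def)
  also have "\<dots> = tensor_state (reduced_density M) (reduced_density N) $$ (i, i')"
    by (rule tensor_state_index[symmetric, OF reduced_density_carrier[OF M] reduced_density_carrier[OF N] i])
  finally show "reduced_density (tensor_state M N) $$ (i, i') =
      tensor_state (reduced_density M) (reduced_density N) $$ (i, i')" .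
qed

text \<open>The reduced density matrix is M times its adjoint, so it is positive semidefinite: an
  eigenvalue is a quotient of two squared norms, which gives both claims at once.\<close>

lemma reduced_density_eigenvalue_nonneg:
  assumes M: "M \<in> carrier_mat m n" and k: "k \<in># proots (char_poly (reduced_density M))"
  shows "k \<in> \<real>" "0 \<le> Re k"
proof -
  note R = reduced_density_carrier[OF M]
  have "char_poly (reduced_density M) \<noteq> 0"
    using degree_monic_char_poly[OF R] by auto
  then have "eigenvalue (reduced_density M) k"
    using k by (simp add: eigenvalue_root_char_poly[OF R])
  then obtain v where v: "v \<in> carrier_vec m" "v \<noteq> 0\<^sub>v m"
    and ev: "reduced_density M *\<^sub>v v = k \<cdot>\<^sub>v v"
    using R by (auto simp: eigenvalue_def eigenvector_def)
  \<comment> \<open>\<open>S\<close> is the squared norm of the eigenvector v, and \<open>T\<close>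
    that of the row vector obtained by multiplying the adjoint of v by M.\<close>
  define S where "S = (\<Sum>i<m. (cmod (v $ i))\<^sup>2)"
  define T where "T = (\<Sum>j<n. (cmod (\<Sum>i<m. cnj (v $ i) * M $$ (i, j)))\<^sup>2)"
  obtain i where "i < m" "v $ i \<noteq> 0"
    using v by (metis carrier_vecD eq_vecI index_zero_vec(1) index_zero_vec(2))
  then have S: "S > 0"
    unfolding S_def by (intro sum_pos2[of _ i]) auto
  have "k * of_real S = (\<Sum>i<m. cnj (v $ i) * (k \<cdot>\<^sub>v v) $ i)"
    using v by (auto simp: S_def sum_distrib_left complex_norm_square mult_ac simp del: of_real_power intro!: sum.cong)
  also have "\<dots> = (\<Sum>i<m. cnj (v $ i) * (\<Sum>i'<m. (\<Sum>j<n. M $$ (i, j) * cnj (M $$ (i', j))) * v $ i'))"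
    unfolding ev[symmetric] using M v
    by (intro sum.cong) (auto simp: reduced_density_def scalar_prod_def lessThan_atLeast0)
  also have "\<dots> = (\<Sum>i<m. \<Sum>i'<m. \<Sum>j<n. (cnj (v $ i) * M $$ (i, j)) * (v $ i' * cnj (M $$ (i', j))))"
    by (simp add: sum_distrib_left sum_distrib_right mult_ac)
  \<comment> \<open>With the sum over j moved outermost, the remaining double sum is a complex
    number times its conjugate.\<close>
  also have "\<dots> = (\<Sum>i<m. \<Sum>j<n. \<Sum>i'<m. (cnj (v $ i) * M $$ (i, j)) * (v $ i' * cnj (M $$ (i', j))))"
    by (intro sum.cong refl sum.swap)
  also have "\<dots> = (\<Sum>j<n. \<Sum>i<m. \<Sum>i'<m. (cnj (v $ i) * M $$ (i, j)) * (v $ i' * cnj (M $$ (i', j))))"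
    by (rule sum.swap)
  also have "\<dots> = of_real T"
    unfolding T_def by (simp add: complex_norm_square sum_product del: of_real_power)
  finally have "k = of_real (T / S)"
    using S by (simp add: field_simps)
  moreover have "T \<ge> 0" unfolding T_def by (intro sum_nonneg) auto
  ultimately show "k \<in> \<real>" "0 \<le> Re k" using S by auto
qed

lemma mset_schmidt_coeffs:
  "mset (schmidt_coeffs M) = image_mset Re (proots (char_poly (reduced_density M)))"
  by (simp add: schmidt_coeffs_def)

lemma set_schmidt_coeffs:
  "set (schmidt_coeffs M) = Re ` set_mset (proots (char_poly (reduced_density M)))"
  by (metis mset_schmidt_coeffs set_image_mset set_mset_mset)

lemma length_schmidt_coeffs:
  assumes "M \<in> carrier_mat m n"
  shows "length (schmidt_coeffs M) = m"
  using degree_monic_char_poly[OF reduced_density_carrier[OF assms]]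
  by (metis mset_schmidt_coeffs size_image_mset size_mset size_proots_complex)

lemma schmidt_coeffs_nonneg:
  assumes "M \<in> carrier_mat m n" "x \<in> set (schmidt_coeffs M)"
  shows "0 \<le> x"
  using assms reduced_density_eigenvalue_nonneg(2) by (auto simp: set_schmidt_coeffs)

text \<open>The coefficients sum to the trace of the reduced density matrix, and this trace is the
  squared norm of the state.\<close>

lemma sum_list_schmidt_coeffs:
  assumes "pure_state m n M"
  shows "sum_list (schmidt_coeffs M) = 1"
proof -
  have M: "M \<in> carrier_mat m n" and norm: "(\<Sum>i<m. \<Sum>j<n. (cmod (M $$ (i, j)))\<^sup>2) = 1"
    using assms by (auto simp: pure_state_def)
  have Re_sum: "sum_mset (image_mset Re X) = Re (sum_mset X)" for X
    by (induction X) auto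
  have "sum_list (schmidt_coeffs M) = Re (\<Sum>i<m. reduced_density M $$ (i, i))"
    using sum_mset_proots_char_poly[OF reduced_density_carrier[OF M]]
    by (metis Re_sum mset_schmidt_coeffs sum_mset_sum_list)
  also have "\<dots> = (\<Sum>i<m. \<Sum>j<n. (cmod (M $$ (i, j)))\<^sup>2)"
    using M by (auto simp: reduced_density_def complex_mult_cnj cmod_power2 intro!: sum.cong)
  finally show ?thesis using norm by simp
qed

lemma set_schmidt_coeffs_tensor_state:
  assumes M: "M \<in> carrier_mat m n" and N: "N \<in> carrier_mat k l"
  shows "set (schmidt_coeffs (tensor_state M N)) =
    {a * b | a b. a \<in> set (schmidt_coeffs M) \<and> b \<in> set (schmidt_coeffs N)}"
proof -
  \<comment> \<open>\<open>Re\<close> is not multiplicative on complex numbers in general; it is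
    here because the eigenvalue a is real.\<close>
  have Re: "Re (a * b) = Re a * Re b"
    if "a \<in># proots (char_poly (reduced_density M))" for a b
    using reduced_density_eigenvalue_nonneg(1)[OF M that] by (auto elim: Reals_cases)
  have "Re ` {a * b | a b. a \<in> X \<and> b \<in> Y} = {x * y | x y. x \<in> Re ` X \<and> y \<in> Re ` Y}"
    if mult: "\<And>a b. a \<in> X \<Longrightarrow> Re (a * b) = Re a * Re b" for X Y
  proof (intro equalityI subsetI)
    fix z assume "z \<in> Re ` {a * b | a b. a \<in> X \<and> b \<in> Y}"
    then show "z \<in> {x * y | x y. x \<in> Re ` X \<and> y \<in> Re ` Y}" using mult by blast
  next
    fix z assume "z \<in> {x * y | x y. x \<in> Re ` X \<and> y \<in> Re ` Y}"
    then obtain a b where ab: "a \<in> X" "b \<in> Y" "z = Re a * Re b" by auto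
    then have "z = Re (a * b)" using mult[of a b] by simp
    then show "z \<in> Re ` {a * b | a b. a \<in> X \<and> b \<in> Y}"
      by (rule image_eqI) (use ab in blast)
  qed
  from this[OF Re, of _ "set_mset (proots (char_poly (reduced_density N)))"] show ?thesis
    unfolding set_schmidt_coeffs reduced_density_tensor_state[OF M N]
      set_proots_char_poly_tensor_state[OF reduced_density_carrier[OF M] reduced_density_carrier[OF N]]
    by simp
qed

subsection \<open>The largest Schmidt coefficient\<close>

definition max_schmidt :: "complex mat \<Rightarrow> real" where
  "max_schmidt M = Max (set (schmidt_coeffs M))"

text \<open>The list is in descending order, so its head is the maximum. This ties the first partial
  sum of majorization to \<open>max_schmidt\<close>.\<close>

lemma schmidt_coeffs_nth_0:
  assumes "schmidt_coeffs M \<noteq> []"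
  shows "schmidt_coeffs M ! 0 = max_schmidt M"
proof -
  have "sorted_wrt (\<ge>) (schmidt_coeffs M)"
    by (simp add: schmidt_coeffs_def sorted_wrt_rev)
  then show ?thesis
    using assms unfolding max_schmidt_def
    by (cases "schmidt_coeffs M") (auto intro!: Max_eqI[symmetric])
qed

text \<open>Nonnegativity of the coefficients makes the product of the two maxima dominate every
  other product.\<close>

lemma max_schmidt_tensor_state:
  assumes M: "M \<in> carrier_mat m n" "0 < m" and N: "N \<in> carrier_mat k l" "0 < k"
  shows "max_schmidt (tensor_state M N) = max_schmidt M * max_schmidt N"
proof -
  have ne: "set (schmidt_coeffs M) \<noteq> {}" "set (schmidt_coeffs N) \<noteq> {}"
    using length_schmidt_coeffs[OF M(1)] length_schmidt_coeffs[OF N(1)] M N by auto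
  have mem: "max_schmidt M \<in> set (schmidt_coeffs M)" "max_schmidt N \<in> set (schmidt_coeffs N)"
    unfolding max_schmidt_def using ne by (auto intro: Max_in)
  have le: "a * b \<le> max_schmidt M * max_schmidt N"
    if "a \<in> set (schmidt_coeffs M)" "b \<in> set (schmidt_coeffs N)" for a b
    using that mem schmidt_coeffs_nonneg[OF M(1)] schmidt_coeffs_nonneg[OF N(1)]
    by (intro mult_mono) (auto simp: max_schmidt_def)
  show ?thesis
    unfolding max_schmidt_def[of "tensor_state M N"]
    by (rule Max_eqI[OF List.finite_set])
       (use mem le in \<open>auto simp: set_schmidt_coeffs_tensor_state[OF M(1) N(1)]\<close>)
qed

text \<open>Otherwise no coefficient would be positive and they could not sum to 1. Positivity is
  what allows the catalyst to be cancelled.\<close>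

lemma max_schmidt_pos:
  assumes "pure_state m n M"
  shows "0 < max_schmidt M"
proof (rule ccontr)
  assume "\<not> 0 < max_schmidt M"
  then have "x \<le> 0" if "x \<in> set (schmidt_coeffs M)" for x
    using that unfolding max_schmidt_def by (meson List.finite_set Max_ge not_le order.trans)
  then have "sum_list (schmidt_coeffs M) \<le> 0"
    by (simp add: sum_list_nonpos)
  then show False using sum_list_schmidt_coeffs[OF assms] by simp
qed

section \<open>Majorization and catalysis\<close>

lemma locc_transformable_max_schmidt_le:
  assumes "locc_transformable M N" "M \<in> carrier_mat m n" "N \<in> carrier_mat k l" "0 < m" "0 < k"
  shows "max_schmidt M \<le> max_schmidt N"
proof -
  have len: "length (schmidt_coeffs M) = m" "length (schmidt_coeffs N) = k"
    using assms length_schmidt_coeffs by blast+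
  then have "1 \<in> {1..max (length (schmidt_coeffs M)) (length (schmidt_coeffs N))}"
    using assms by auto
  \<comment> \<open>At k = 1 the partial sums are the entries at index 0; both lists are nonempty,
    so the padding value is not what is read there.\<close>
  then have "nth_default 0 (schmidt_coeffs M) 0 \<le> nth_default 0 (schmidt_coeffs N) 0"
    using assms(1) unfolding locc_transformable_def Let_def by force
  moreover have "schmidt_coeffs M \<noteq> []" "schmidt_coeffs N \<noteq> []" using len assms by auto
  ultimately show ?thesis
    by (simp add: nth_default_nth schmidt_coeffs_nth_0)
qed

lemma catalytic_max_schmidt_le:
  assumes "catalytic_locc_transformable M N" "M \<in> carrier_mat m n" "N \<in> carrier_mat k l" "0 < m" "0 < k"
  shows "max_schmidt M \<le> max_schmidt N"
proof -
  obtain u v C where C: "pure_state u v C"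
    and tr: "locc_transformable (tensor_state M C) (tensor_state N C)"
    using assms(1) by (auto simp: catalytic_locc_transformable_def)
  \<comment> \<open>A catalyst with no rows would have norm 0 instead of 1.\<close>
  have C': "C \<in> carrier_mat u v" "0 < u"
    using C by (auto simp: pure_state_def intro: ccontr)
  have "max_schmidt (tensor_state M C) \<le> max_schmidt (tensor_state N C)"
    using locc_transformable_max_schmidt_le[OF tr tensor_state_carrier[OF assms(2) C'(1)] tensor_state_carrier[OF assms(3) C'(1)]]
      assms C' by simp
  \<comment> \<open>Both sides carry the positive factor \<open>max_schmidt C\<close>, which is
    divided out.\<close>
  then show ?thesis
    using assms C' max_schmidt_pos[OF C] by (simp add: max_schmidt_tensor_state)
qed

section \<open>Entropy of a two-qubit state\<close>

lemma qubit_entanglement: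
  assumes "pure_state 2 2 M"
  shows "1/2 \<le> max_schmidt M" "max_schmidt M \<le> 1"
    and "entanglement_entropy M = bin_entropy (max_schmidt M) / ln 2"
proof -
  have M: "M \<in> carrier_mat 2 2" using assms by (simp add: pure_state_def)
  have "length (schmidt_coeffs M) = Suc (Suc 0)"
    using length_schmidt_coeffs[OF M] by simp
  then obtain a b where ab: "schmidt_coeffs M = [a, b]"
    by (metis length_0_conv length_Suc_conv)
  have max: "max_schmidt M = a" using schmidt_coeffs_nth_0[of M] ab by simp
  \<comment> \<open>Normalization leaves one free coefficient; being the larger of two that sum to
    1, it lies between 1/2 and 1.\<close>
  have sum: "b = 1 - a" using sum_list_schmidt_coeffs[OF assms] ab by simp
  have "0 \<le> b" using schmidt_coeffs_nonneg[OF M] ab by simp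
  moreover have "b \<le> a" using max by (simp add: max_schmidt_def ab max_def split: if_splits)
  ultimately show "1/2 \<le> max_schmidt M" "max_schmidt M \<le> 1"
    using max sum by auto
  show "entanglement_entropy M = bin_entropy (max_schmidt M) / ln 2"
    unfolding entanglement_entropy_def ab max bin_entropy_def
    by (simp add: sum log_def field_simps)
qed

theorem mainTheorem2:
  fixes \<psi> \<phi> \<psi>' \<phi>' :: "complex mat" and \<Delta>E :: real
  assumes "pure_state 2 2 \<psi>" and "pure_state 2 2 \<phi>"
    and "\<Delta>E > 0"
    and "\<Delta>E \<le> entanglement_entropy \<psi>"
    and "entanglement_entropy \<phi> + \<Delta>E \<le> 1"
    and "pure_state 2 2 \<psi>'" and "pure_state 2 2 \<phi>'"
    and "entanglement_entropy \<psi>' = entanglement_entropy \<psi> - \<Delta>E"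
    and "entanglement_entropy \<phi>' = entanglement_entropy \<phi> + \<Delta>E"
    and "catalytic_locc_transformable (tensor_state \<psi> \<phi>) (tensor_state \<psi>' \<phi>')"
  shows "entanglement_entropy \<phi> \<le> entanglement_entropy \<psi> - \<Delta>E"
proof -
  have carrier: "\<psi> \<in> carrier_mat 2 2" "\<phi> \<in> carrier_mat 2 2" "\<psi>' \<in> carrier_mat 2 2" "\<phi>' \<in> carrier_mat 2 2"
    using assms by (auto simp: pure_state_def)
  have "max_schmidt (tensor_state \<psi> \<phi>) \<le> max_schmidt (tensor_state \<psi>' \<phi>')"
    using catalytic_max_schmidt_le[OF assms(10) tensor_state_carrier[OF carrier(1,2)]
        tensor_state_carrier[OF carrier(3,4)]]
    by simp
  then have prod: "max_schmidt \<psi> * max_schmidt \<phi> \<le> max_schmidt \<psi>' * max_schmidt \<phi>'"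
    using carrier by (simp add: max_schmidt_tensor_state)
  note ent = qubit_entanglement(3)[OF assms(1)] qubit_entanglement(3)[OF assms(2)]
    qubit_entanglement(3)[OF assms(6)] qubit_entanglement(3)[OF assms(7)]
  \<comment> \<open>The transferred amount cancels in the total, so the sum of the two entropies is
    conserved.\<close>
  have "(bin_entropy (max_schmidt \<psi>) + bin_entropy (max_schmidt \<phi>)) / ln 2 =
      (bin_entropy (max_schmidt \<psi>') + bin_entropy (max_schmidt \<phi>')) / ln 2"
    using assms(8,9) by (simp add: ent add_divide_distrib)
  then have "bin_entropy (max_schmidt \<psi>) + bin_entropy (max_schmidt \<phi>) =
      bin_entropy (max_schmidt \<psi>') + bin_entropy (max_schmidt \<phi>')"
    by simp
  moreover have "bin_entropy (max_schmidt \<phi>) / ln 2 < bin_entropy (max_schmidt \<phi>') / ln 2"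
    using assms(3,9) by (simp add: ent)
  then have "bin_entropy (max_schmidt \<phi>) < bin_entropy (max_schmidt \<phi>')"
    by (simp add: divide_less_cancel)
  ultimately have "bin_entropy (max_schmidt \<phi>) \<le> bin_entropy (max_schmidt \<psi>')"
    using qubit_entanglement(1,2)[OF assms(1)] qubit_entanglement(1,2)[OF assms(2)]
      qubit_entanglement(1,2)[OF assms(6)] qubit_entanglement(1,2)[OF assms(7)] prod
    by (intro entropy_balance_le[of "max_schmidt \<psi>" _ _ "max_schmidt \<phi>'"])
  then have "entanglement_entropy \<phi> \<le> entanglement_entropy \<psi>'"
    by (simp add: ent divide_right_mono)
  then show ?thesis using assms(8) by simp
qed

end
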